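(* Let $S, A$ be nonempty finite sets and let $T \subseteq S \triangleright A$ be a set of policies. If $T$ is closed under trajectory splicing, then $T$ has the value-laden Bellman property for teleo-optimality; that is: for every policy $\pi \in T$ that is $T$-optimal for a teleo-environment $\varepsilon \in A \triangleright (S \times G)$, every $n \in \mathbb{N}$ and every trajectory $(\mathbf{a}, \mathbf{s}) \in A^n \times S^n$, if the evolutions $\varepsilon' = \varepsilon \bullet (\mathbf{a} : (\mathbf{s} : \bot^n))$ and $\pi' = \pi \bullet (\mathbf{s} : \mathbf{a})$ are valid, then $\pi'$ is $T'$-optimal for $\varepsilon'$, where $T' = T \bullet (\mathbf{s} : \mathbf{a})$.
   Context: For a finite set $X$, $P(X)$ is the set of probability distributions on $X$ and $\mathrm{supp}(p)$ is the support of $p\in P(X)$. For finite sets $I$ (inputs) and $O$ (outputs), the set $I \triangleright O$ of transducers is defined coinductively (it is the final coalgebra of $X \mapsto \sum_{p \in P(O)} (I \times \mathrm{supp}(p) \to X)$): a transducer $\pi$ is a pair $(\mathbb{P}_\pi, \mathbb{T}_\pi)$ with $\mathbb{P}_\pi \in P(O)$ and $\mathbb{T}_\pi : I \times \mathrm{supp}(\mathbb{P}_\pi) \to I \triangleright O$. Evolution: for strings $\mathbf{i}\in I^n$, $\mathbf{o}\in O^n$, $(\mathbf{i}:\mathbf{o})$ denotes the string of pairs $(\mathbf i_k,\mathbf o_k)$. Evolution by the empty string is $\pi$, and $\pi \bullet (\mathbf{i}\cdot i : \mathbf{o} \cdot o) = \mathbb{T}_{\pi \bullet (\mathbf{i}:\mathbf{o})}(i,o)$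 if $\pi\bullet(\mathbf{i}:\mathbf{o})$ is defined and $o \in \mathrm{supp}(\mathbb{P}_{\pi\bullet(\mathbf{i}:\mathbf{o})})$; otherwise it is undefined. An evolution is valid if it is defined. For $T \subseteq I \triangleright O$, $T\bullet(\mathbf{i}:\mathbf{o}) = \{\pi'\bullet(\mathbf{i}:\mathbf{o}) : \pi' \in T,\ \text{the evolution is valid}\}$. Splicing: for $\pi,\pi' \in I \triangleright O$ and a trajectory valid for evolving $\pi$, $\pi \curlyvee_{(\mathbf{i}:\mathbf{o})} \pi'$ is defined inductively: along the empty trajectory it is $\pi'$; along $(i\cdot\mathbf{i} : o\cdot\mathbf{o})$ it is the transducer with output distribution $\mathbb{P}_\pi$ whose transition sends $(i,o)$ to $(\pi\bullet(i,o)) \curlyvee_{(\mathbf{i}:\mathbf{o})} \pi'$ and any other $(j,q)$ to $\pi\bullet(j,q)$. $T$ is closed under trajectory splicing if for all $\pi,\pi'\in T$ and every trajectory $(\mathbf{i}:\mathbf{o}) \in (I\times O)^*$ valid for evolving both, $\pi \curlyvee_{(\mathbf{i}:\mathbf{o})} (\pi'\bullet(\mathbf{i}:\mathbf{o})) \in T$. Let $G = \{\bot,\top\}$ ($\top$ = success). A policy is an element of $S\triangleright A$; a teleo-environment is an element of $A \triangleright (S\times G)$; $\bot^n$ is the string of $n$ copies of $\bot$. The success probability $\mathcal{S}(\pi,\varepsilon)$ (the probability that $\top$ is emitted at least once when $\pi$ and $\varepsilon$ are coupled) is $\lim_{n\to\infty} \mathcal{S}_n(\pi,\varepsilon)$,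 where $\mathcal{S}_0(\pi,\varepsilon) = \sum_{s\in S} \mathbb{P}_\varepsilon(s,\top)$ and $\mathcal{S}_{n+1}(\pi,\varepsilon) = \sum_{s\in S}\sum_{a\in A} \left[\mathbb{P}_\pi(a)\mathbb{P}_\varepsilon(s,\top) + \mathbb{P}_\pi(a)\mathbb{P}_\varepsilon(s,\bot)\, \mathcal{S}_n\big(\mathbb{T}_\pi(s,a), \mathbb{T}_\varepsilon(a,(s,\bot))\big)\right]$ (terms with zero coefficient are omitted). For $T\subseteq S\triangleright A$, a policy $\pi\in T$ is $T$-optimal for $\varepsilon$ if $\mathcal{S}(\pi',\varepsilon)\le \mathcal{S}(\pi,\varepsilon)$ for all $\pi'\in T$. *)

theory Defs
  imports "HOL-Probability.Probability_Mass_Function"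
begin

text \<open>
  The input and output sets are modelled by finite types (which are nonempty). The codatatype
  below is larger than the set of transducers: \<open>step p x y = None\<close> encodes that
  the transition is undefined at \<open>(x, y)\<close>, and membership in \<open>transducers\<close> demands,
  hereditarily, that it is undefined exactly when \<open>y\<close> is outside the support of the output
  distribution. Equality of elements is bisimilarity, so \<open>transducers\<close> is the final coalgebra
  of the functor mapping \<open>X\<close> to the pairs of a distribution \<open>p\<close> and
  a function from inputs and elements of the support of \<open>p\<close> to \<open>X\<close>; see
  \<open>transducers_final\<close>.
\<close>

codatatype ('i, 'o) pre_transducer =
  Transducer (out: "'o pmf") (step: "'i \<Rightarrow> 'o \<Rightarrow> ('i, 'o) pre_transducer option")

coinductive_set transducers :: "('i, 'o) pre_transducer set" where
  "\<lbrakk>\<And>x y. step \<pi> x y \<noteq> None \<longleftrightarrow> y \<in> set_pmf (out \<pi>);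
    \<And>x y \<rho>. step \<pi> x y = Some \<rho> \<Longrightarrow> \<rho> \<in> transducers\<rbrakk> \<Longrightarrow> \<pi> \<in> transducers"

primcorec unfold_transducer ::
  "('x \<Rightarrow> 'o pmf) \<Rightarrow> ('x \<Rightarrow> 'i \<Rightarrow> 'o \<Rightarrow> 'x option) \<Rightarrow> 'x \<Rightarrow> ('i, 'o) pre_transducer" where
  "out (unfold_transducer p t x) = p x"
| "step (unfold_transducer p t x) =
     (\<lambda>i y. map_option (unfold_transducer p t) (t x i y))"

lemma transducers_final:
  fixes p :: "'x \<Rightarrow> 'o pmf" and t :: "'x \<Rightarrow> 'i \<Rightarrow> 'o \<Rightarrow> 'x option"
  assumes dom: "\<And>x i y. t x i y \<noteq> None \<longleftrightarrow> y \<in> set_pmf (p x)"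
  shows "\<exists>!h. \<forall>x. h x \<in> transducers \<and> out (h x) = p x \<and>
           (\<forall>i y. step (h x) i y = map_option h (t x i y))"
proof (rule ex1I)
  let ?u = "unfold_transducer p t"
  have "?u x \<in> transducers" for x
  proof (coinduction arbitrary: x)
    case transducers
    then show ?case using dom by fastforce
  qed
  then show "\<forall>x. ?u x \<in> transducers \<and> out (?u x) = p x \<and>
           (\<forall>i y. step (?u x) i y = map_option ?u (t x i y))"
    by simp
next
  fix h :: "'x \<Rightarrow> ('i, 'o) pre_transducer"
  assume h: "\<forall>x. h x \<in> transducers \<and> out (h x) = p x \<and>
           (\<forall>i y. step (h x) i y = map_option h (t x i y))"
  have "h x = unfold_transducer p t x" for x
  proof (coinduction arbitrary: x)
    case Eq_pre_transducer
    show ?case using h by (auto simp: rel_fun_def option.rel_map intro!: option.rel_refl)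
  qed
  then show "h = unfold_transducer p t" by blast
qed

definition evolve :: "('i, 'o) pre_transducer \<Rightarrow> ('i \<times> 'o) list \<Rightarrow> ('i, 'o) pre_transducer option" where
  "evolve \<pi> tr =
     foldl (\<lambda>r (x, y). case r of None \<Rightarrow> None
              | Some \<rho> \<Rightarrow> (if y \<in> set_pmf (out \<rho>) then step \<rho> x y else None))
       (Some \<pi>) tr"

lemma evolve_Nil: "evolve \<pi> [] = Some \<pi>"
  by (simp add: evolve_def)

lemma evolve_snoc:
  "evolve \<pi> (tr @ [(x, y)]) =
     (case evolve \<pi> tr of None \<Rightarrow> None
      | Some \<rho> \<Rightarrow> (if y \<in> set_pmf (out \<rho>) then step \<rho> x y else None))"
  by (simp add: evolve_def)

definition evolve_set :: "('i, 'o) pre_transducer set \<Rightarrow> ('i \<times> 'o) list \<Rightarrow> ('i, 'o) pre_transducer set" where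
  "evolve_set T tr = {\<rho>. \<exists>\<pi>\<in>T. evolve \<pi> tr = Some \<rho>}"

text \<open>Splicing is only meaningful along trajectories valid for evolving the first transducer.\<close>

fun splice_along ::
  "('i, 'o) pre_transducer \<Rightarrow> ('i \<times> 'o) list \<Rightarrow> ('i, 'o) pre_transducer \<Rightarrow> ('i, 'o) pre_transducer" where
  "splice_along \<pi> [] \<pi>' = \<pi>'"
| "splice_along \<pi> ((x, y) # tr) \<pi>' =
     Transducer (out \<pi>)
       (\<lambda>j q. if j = x \<and> q = y then map_option (\<lambda>\<rho>. splice_along \<rho> tr \<pi>') (step \<pi> x y)
              else step \<pi> j q)"

definition closed_under_splicing :: "('i, 'o) pre_transducer set \<Rightarrow> bool" where
  "closed_under_splicing T \<longleftrightarrow>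
     (\<forall>\<pi>\<in>T. \<forall>\<pi>'\<in>T. \<forall>tr \<rho> \<rho>'. evolve \<pi> tr = Some \<rho> \<longrightarrow> evolve \<pi>' tr = Some \<rho>' \<longrightarrow>
        splice_along \<pi> tr \<rho>' \<in> T)"

text \<open>
  The goal signal is a Boolean, \<open>True\<close> meaning success. In the recursive case, a zero coefficient
  annihilates its (then possibly meaningless) factor, so such terms are omitted.
\<close>

primrec success_upto ::
  "nat \<Rightarrow> ('s::finite, 'a::finite) pre_transducer \<Rightarrow> ('a, 's \<times> bool) pre_transducer \<Rightarrow> real" where
  "success_upto 0 \<pi> \<epsilon> = (\<Sum>s\<in>UNIV. pmf (out \<epsilon>) (s, True))"
| "success_upto (Suc n) \<pi> \<epsilon> =
     (\<Sum>s\<in>UNIV. \<Sum>a\<in>UNIV.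
        pmf (out \<pi>) a * pmf (out \<epsilon>) (s, True) +
        pmf (out \<pi>) a * pmf (out \<epsilon>) (s, False) *
          success_upto n (the (step \<pi> s a)) (the (step \<epsilon> a (s, False))))"

definition success ::
  "('s::finite, 'a::finite) pre_transducer \<Rightarrow> ('a, 's \<times> bool) pre_transducer \<Rightarrow> real" where
  "success \<pi> \<epsilon> = lim (\<lambda>n. success_upto n \<pi> \<epsilon>)"

lemma success_upto_nonneg: "0 \<le> success_upto n \<pi> \<epsilon>"
  by (induction n arbitrary: \<pi> \<epsilon>) (auto intro!: sum_nonneg add_nonneg_nonneg mult_nonneg_nonneg)

lemma sum_pmf_finite: "(\<Sum>x\<in>UNIV. pmf p (x :: 'b::finite)) = 1"
  by (rule sum_pmf_eq_1) auto

lemma sum_pmf_goal: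
  "(\<Sum>s\<in>UNIV. pmf p (s :: 's::finite, True)) + (\<Sum>s\<in>UNIV. pmf p (s, False)) = 1"
proof -
  have "(\<Sum>z\<in>UNIV \<times> UNIV. pmf p z) = 1"
    using sum_pmf_finite[of p] by simp
  then have "(\<Sum>s\<in>UNIV. \<Sum>g\<in>UNIV. pmf p (s, g)) = 1"
    by (simp add: sum.cartesian_product)
  then show ?thesis
    by (simp add: UNIV_bool sum.distrib add.commute)
qed

lemma success_upto_le_1: "success_upto n \<pi> \<epsilon> \<le> 1"
proof (induction n arbitrary: \<pi> \<epsilon>)
  case 0
  have "0 \<le> (\<Sum>s\<in>UNIV. pmf (out \<epsilon>) (s, False))" by (simp add: sum_nonneg)
  with sum_pmf_goal[of "out \<epsilon>"] show ?case by simp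
next
  case (Suc n)
  have "success_upto (Suc n) \<pi> \<epsilon> \<le>
    (\<Sum>s\<in>UNIV. \<Sum>a\<in>UNIV. pmf (out \<pi>) a * (pmf (out \<epsilon>) (s, True) + pmf (out \<epsilon>) (s, False)))"
    by (auto intro!: sum_mono mult_left_le Suc simp: distrib_left)
  also have "\<dots> = 1"
    by (simp add: sum_distrib_right[symmetric] sum_pmf_finite sum.distrib sum_pmf_goal)
  finally show ?case .
qed

lemma success_upto_mono: "success_upto n \<pi> \<epsilon> \<le> success_upto (Suc n) \<pi> \<epsilon>"
proof (induction n arbitrary: \<pi> \<epsilon>)
  case 0
  have "success_upto 0 \<pi> \<epsilon> = (\<Sum>s\<in>UNIV. \<Sum>a\<in>UNIV. pmf (out \<pi>) a * pmf (out \<epsilon>) (s, True))"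
    by (simp add: sum_distrib_right[symmetric] sum_pmf_finite)
  also have "\<dots> \<le> success_upto (Suc 0) \<pi> \<epsilon>"
    unfolding success_upto.simps(2)
    by (intro sum_mono) (simp add: sum_nonneg)
  finally show ?case .
next
  case (Suc n)
  show ?case
    unfolding success_upto.simps(2)[of "Suc n"]
    by (subst success_upto.simps(2)) (intro sum_mono add_left_mono mult_left_mono Suc; simp)
qed

lemma success_upto_convergent: "(\<lambda>n. success_upto n \<pi> \<epsilon>) \<longlonglongrightarrow> success \<pi> \<epsilon>"
proof -
  have "incseq (\<lambda>n. success_upto n \<pi> \<epsilon>)"
    by (rule incseq_SucI) (rule success_upto_mono)
  then have "convergent (\<lambda>n. success_upto n \<pi> \<epsilon>)"
    using incseq_convergent success_upto_le_1 by (metis convergent_def)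
  then show ?thesis
    by (simp add: success_def convergent_LIMSEQ_iff)
qed

definition optimal ::
  "('s::finite, 'a::finite) pre_transducer set \<Rightarrow> ('s, 'a) pre_transducer \<Rightarrow>
   ('a, 's \<times> bool) pre_transducer \<Rightarrow> bool" where
  "optimal T \<pi> \<epsilon> \<longleftrightarrow> \<pi> \<in> T \<and> (\<forall>\<pi>'\<in>T. success \<pi>' \<epsilon> \<le> success \<pi> \<epsilon>)"

definition value_laden_bellman :: "('s::finite, 'a::finite) pre_transducer set \<Rightarrow> bool" where
  "value_laden_bellman T \<longleftrightarrow>
     (\<forall>\<pi>\<in>T. \<forall>\<epsilon>\<in>transducers. optimal T \<pi> \<epsilon> \<longrightarrow>
        (\<forall>n as ss \<pi>' \<epsilon>'. length as = n \<longrightarrow> length ss = n \<longrightarrow>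
           evolve \<epsilon> (zip as (zip ss (replicate n False))) = Some \<epsilon>' \<longrightarrow>
           evolve \<pi> (zip ss as) = Some \<pi>' \<longrightarrow>
           optimal (evolve_set T (zip ss as)) \<pi>' \<epsilon>'))"

end

theory Submission
  imports Defs
begin

text \<open>
  Splicing \<open>\<rho>\<close> into \<open>\<pi>\<close> along a trajectory alters the success probability only through the
  event that the trajectory is realised without success. That event has a positive probability \<open>c\<close>
  which does not depend on \<open>\<rho>\<close>, so the success probability changes by \<open>c\<close> times the difference
  between the success probabilities of \<open>\<rho>\<close> and of the evolved policy against the evolved environment.
  Hence a better continuation within \<open>evolve_set T tr\<close> would, by closure under splicing,
  give a policy in \<open>T\<close> better than the optimal one.
\<close>

text \<open>\<open>evolve\<close> folds from the left while \<open>splice_along\<close> recurses on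
  the head of the trajectory. An undefined evolution stays undefined, so the first step can be
  peeled off.\<close>

lemma evolve_Cons:
  "evolve \<pi> ((x, y) # tr) =
     (if y \<in> set_pmf (out \<pi>) then Option.bind (step \<pi> x y) (\<lambda>\<rho>. evolve \<rho> tr) else None)"
proof -
  have "foldl (\<lambda>r (x, y). case r of None \<Rightarrow> None
      | Some \<rho> \<Rightarrow> (if y \<in> set_pmf (out \<rho>) then step \<rho> x y else None)) None tr = None"
    for tr :: "('a \<times> 'b) list"
    by (induction tr) auto
  then show ?thesis
    by (cases "step \<pi> x y") (auto simp: evolve_def)
qed

text \<open>The sums are finite and \<open>success_upto\<close> converges for all arguments, even
  the arbitrary values of \<open>the None\<close>, so the limit passes through the
  recursion.\<close>

lemma success_unfold:
  "success \<pi> \<epsilon> =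
     (\<Sum>s\<in>UNIV. \<Sum>a\<in>UNIV.
        pmf (out \<pi>) a * pmf (out \<epsilon>) (s, True) +
        pmf (out \<pi>) a * pmf (out \<epsilon>) (s, False) *
          success (the (step \<pi> s a)) (the (step \<epsilon> a (s, False))))"
proof (rule LIMSEQ_unique)
  show "(\<lambda>n. success_upto (Suc n) \<pi> \<epsilon>) \<longlonglongrightarrow> success \<pi> \<epsilon>"
    by (rule LIMSEQ_Suc) (rule success_upto_convergent)
  show "(\<lambda>n. success_upto (Suc n) \<pi> \<epsilon>) \<longlonglongrightarrow>
     (\<Sum>s\<in>UNIV. \<Sum>a\<in>UNIV.
        pmf (out \<pi>) a * pmf (out \<epsilon>) (s, True) +
        pmf (out \<pi>) a * pmf (out \<epsilon>) (s, False) *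
          success (the (step \<pi> s a)) (the (step \<epsilon> a (s, False))))"
    unfolding success_upto.simps by (intro tendsto_intros success_upto_convergent)
qed

text \<open>The constant \<open>c\<close> is the product of the output probabilities of policy and
  environment along \<open>tr\<close>. It is chosen before \<open>\<rho>\<close>, so that the
  induction hypothesis supplies one constant for all \<open>\<rho>\<close>.\<close>

lemma success_splice_along:
  assumes "evolve \<pi> tr = Some \<pi>'"
    and "evolve \<epsilon> (map (\<lambda>(s, a). (a, (s, False))) tr) = Some \<epsilon>'"
  shows "\<exists>c>0. \<forall>\<rho>. success (splice_along \<pi> tr \<rho>) \<epsilon> =
           success \<pi> \<epsilon> + c * (success \<rho> \<epsilon>' - success \<pi>' \<epsilon>')"
  using assms
proof (induction tr arbitrary: \<pi> \<epsilon>)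
  case Nil
  then show ?case by (auto simp: evolve_Nil intro!: exI[of _ 1])
next
  case (Cons z tr)
  obtain x y where z: "z = (x, y)" by (cases z)
  from Cons.prems(1) obtain \<pi>1 where y: "y \<in> set_pmf (out \<pi>)"
    and step_\<pi>: "step \<pi> x y = Some \<pi>1" and \<pi>1: "evolve \<pi>1 tr = Some \<pi>'"
    by (auto simp: z evolve_Cons bind_eq_Some_conv split: if_splits)
  from Cons.prems(2) obtain \<epsilon>1 where x: "(x, False) \<in> set_pmf (out \<epsilon>)"
    and step_\<epsilon>: "step \<epsilon> y (x, False) = Some \<epsilon>1"
    and \<epsilon>1: "evolve \<epsilon>1 (map (\<lambda>(s, a). (a, (s, False))) tr) = Some \<epsilon>'"
    by (auto simp: z evolve_Cons bind_eq_Some_conv split: if_splits)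
  obtain c where "c > 0" and c: "\<And>\<rho>. success (splice_along \<pi>1 tr \<rho>) \<epsilon>1 =
      success \<pi>1 \<epsilon>1 + c * (success \<rho> \<epsilon>' - success \<pi>' \<epsilon>')"
    using Cons.IH[OF \<pi>1 \<epsilon>1] by blast
  \<comment> \<open>The probability of the first step of the trajectory; both factors are positive
    because the evolutions are valid.\<close>
  define p where "p = pmf (out \<pi>) y * pmf (out \<epsilon>) (x, False)"
  have "p > 0" using x y by (simp add: p_def pmf_positive)
  have "success (splice_along \<pi> (z # tr) \<rho>) \<epsilon> =
      success \<pi> \<epsilon> + p * c * (success \<rho> \<epsilon>' - success \<pi>' \<epsilon>')" for \<rho>
  proof -
    let ?d = "p * c * (success \<rho> \<epsilon>' - success \<pi>' \<epsilon>')"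
    let ?\<sigma> = "splice_along \<pi> (z # tr) \<rho>"
    \<comment> \<open>Only the summand at \<open>(x, y)\<close> changes, by \<open>?d\<close>
      according to the induction hypothesis. The nested conditionals let the two sums collapse one
      after the other.\<close>
    have "success ?\<sigma> \<epsilon> = (\<Sum>s\<in>UNIV. \<Sum>a\<in>UNIV.
        (pmf (out \<pi>) a * pmf (out \<epsilon>) (s, True) +
         pmf (out \<pi>) a * pmf (out \<epsilon>) (s, False) *
           success (the (step \<pi> s a)) (the (step \<epsilon> a (s, False)))) +
        (if s = x then if a = y then ?d else 0 else 0))"
      unfolding success_unfold[of ?\<sigma>]
      by (intro sum.cong refl)
        (auto simp: z step_\<pi> step_\<epsilon> c p_def algebra_simps)
    also have "\<dots> = success \<pi> \<epsilon> + (\<Sum>s\<in>UNIV. \<Sum>a\<in>UNIV. if s = x then if a = y then ?d else 0 else 0)"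
      unfolding success_unfold[of \<pi>] by (simp only: sum.distrib)
    also have "(\<Sum>s\<in>UNIV. \<Sum>a\<in>UNIV. if s = x then if a = y then ?d else 0 else 0) =
        (\<Sum>s\<in>UNIV. if s = x then ?d else 0)"
      by (intro sum.cong refl) simp
    also have "\<dots> = ?d" by simp
    finally show ?thesis .
  qed
  then show ?case using \<open>p > 0\<close> \<open>c > 0\<close> by (intro exI[of _ "p * c"]) auto
qed

text \<open>Expresses the trajectory of the environment through that of the policy, so that one list
  drives both evolutions.\<close>

lemma zip_replicate_right:
  "length as = length ss \<Longrightarrow>
     zip as (zip ss (replicate (length ss) g)) = map (\<lambda>(s, a). (a, (s, g))) (zip ss as)"
  by (induction as ss rule: list_induct2) auto

theorem theorem5p0p2:
  fixes T :: "('s::finite, 'a::finite) pre_transducer set"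
  assumes "T \<subseteq> transducers"
    and "closed_under_splicing T"
  shows "value_laden_bellman T"
  unfolding value_laden_bellman_def
proof (intro ballI allI impI)
  fix \<pi> \<epsilon> n as ss \<pi>' \<epsilon>'
  assume "\<pi> \<in> T" and opt: "optimal T \<pi> \<epsilon>" and len: "length as = n" "length ss = n"
    and \<epsilon>': "evolve \<epsilon> (zip as (zip ss (replicate n False))) = Some \<epsilon>'"
    and \<pi>': "evolve \<pi> (zip ss as) = Some \<pi>'"
  from \<epsilon>' len have "evolve \<epsilon> (map (\<lambda>(s, a). (a, (s, False))) (zip ss as)) = Some \<epsilon>'"
    using zip_replicate_right[of as ss False] by simp
  from success_splice_along[OF \<pi>' this] obtain c where "c > 0"
    and c: "\<And>\<rho>. success (splice_along \<pi> (zip ss as) \<rho>) \<epsilon> =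
      success \<pi> \<epsilon> + c * (success \<rho> \<epsilon>' - success \<pi>' \<epsilon>')"
    by blast
  have "success \<rho> \<epsilon>' \<le> success \<pi>' \<epsilon>'" if \<rho>: "\<rho> \<in> evolve_set T (zip ss as)" for \<rho>
  proof -
    from \<rho> obtain \<sigma> where "\<sigma> \<in> T" "evolve \<sigma> (zip ss as) = Some \<rho>"
      by (auto simp: evolve_set_def)
    \<comment> \<open>Closure applies to \<open>\<pi>\<close> and \<open>\<sigma>\<close>, since the
      trajectory is valid for both and \<open>\<rho>\<close> is what \<open>\<sigma>\<close> evolves
      to.\<close>
    with assms(2) \<open>\<pi> \<in> T\<close> \<pi>' have "splice_along \<pi> (zip ss as) \<rho> \<in> T"
      unfolding closed_under_splicing_def by blast
    with opt have "success (splice_along \<pi> (zip ss as) \<rho>) \<epsilon> \<le> success \<pi> \<epsilon>"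
      by (simp add: optimal_def)
    then have "c * (success \<rho> \<epsilon>' - success \<pi>' \<epsilon>') \<le> 0" by (simp add: c)
    with \<open>c > 0\<close> show ?thesis by (simp add: mult_le_0_iff)
  qed
  moreover have "\<pi>' \<in> evolve_set T (zip ss as)"
    using \<open>\<pi> \<in> T\<close> \<pi>' by (auto simp: evolve_set_def)
  ultimately show "optimal (evolve_set T (zip ss as)) \<pi>' \<epsilon>'"
    by (simp add: optimal_def)
qed

end
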